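(* Let $n>2$ be an integer, let $G=\mathrm{Dc}_n$, and let $\varphi=\varphi_{(r,s)}\in\mathrm{Aut}(G)$, where $r\in\mathcal{U}_{2n}$ and $s\in\mathbb{Z}_{2n}$. Then $\varphi$ is an involution if and only if $r^2\equiv 1\pmod{2n}$ and $s(1+r)\equiv 0\pmod{2n}$.
   Context: $\mathrm{Dc}_n=\langle x,y \mid x^{2n}=1,\ y^2=x^n,\ y^{-1}xy=x^{-1}\rangle$ is the dicyclic group of order $4n$, and $\mathrm{Aut}(G)$ is its automorphism group. $\mathbb{Z}_{2n}$ denotes the integers modulo $2n$ and $\mathcal{U}_{2n}$ denotes the set of units of $\mathbb{Z}_{2n}$. For $n>2$, every automorphism of $\mathrm{Dc}_n$ can be written uniquely as $\varphi_{(r,s)}$ with $r\in\mathcal{U}_{2n}$, $s\in\mathbb{Z}_{2n}$, where $\varphi_{(r,s)}(x)=x^r$ and $\varphi_{(r,s)}(y)=yx^s$. *)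

theory Defs
  imports "HOL-Algebra.Bij" "HOL-Number_Theory.Residues"
begin

section \<open>Groups given by generators and relations\<close>

text \<open>A letter \<open>(a, True)\<close> stands for the generator \<open>a\<close> and \<open>(a, False)\<close> for its formal inverse.
  A pair \<open>(u, v)\<close> of words in \<open>R\<close> stands for the relation \<open>u = v\<close>. The set of generators is
  the whole type \<open>'g\<close>.\<close>

type_synonym 'g word = "('g \<times> bool) list"

inductive pres_eq :: "('g word \<times> 'g word) set \<Rightarrow> 'g word \<Rightarrow> 'g word \<Rightarrow> bool"
  for R where
  relation: "(u, v) \<in> R \<Longrightarrow> pres_eq R u v"
| cancel: "pres_eq R [(a, e), (a, \<not> e)] []"
| refl: "pres_eq R u u"
| sym: "pres_eq R u v \<Longrightarrow> pres_eq R v u"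
| trans: "pres_eq R u v \<Longrightarrow> pres_eq R v w \<Longrightarrow> pres_eq R u w"
| append: "pres_eq R u u' \<Longrightarrow> pres_eq R v v' \<Longrightarrow> pres_eq R (u @ v) (u' @ v')"

definition pres_class :: "('g word \<times> 'g word) set \<Rightarrow> 'g word \<Rightarrow> 'g word set" where
  "pres_class R u = {v. pres_eq R u v}"

definition presented_group :: "('g word \<times> 'g word) set \<Rightarrow> 'g word set monoid" where
  "presented_group R =
     \<lparr>carrier = range (pres_class R),
      monoid.mult = (\<lambda>A B. \<Union>u\<in>A. \<Union>v\<in>B. pres_class R (u @ v)),
      one = pres_class R []\<rparr>"

lemma pres_class_eq_iff: "pres_class R u = pres_class R v \<longleftrightarrow> pres_eq R u v"
  unfolding pres_class_def
  by (auto intro: pres_eq.refl pres_eq.sym pres_eq.trans)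

lemma presented_group_mult:
  "pres_class R u \<otimes>\<^bsub>presented_group R\<^esub> pres_class R v = pres_class R (u @ v)"
proof -
  have *: "pres_class R (u' @ v') = pres_class R (u @ v)"
    if "u' \<in> pres_class R u" "v' \<in> pres_class R v" for u' v'
  proof -
    have "pres_eq R u u'" "pres_eq R v v'"
      using that by (simp_all only: pres_class_def mem_Collect_eq)
    then show ?thesis
      unfolding pres_class_eq_iff by (intro pres_eq.sym[OF pres_eq.append])
  qed
  have self: "w \<in> pres_class R w" for w
    by (simp only: pres_class_def mem_Collect_eq pres_eq.refl)
  have "(\<Union>a\<in>pres_class R u. \<Union>b\<in>pres_class R v. pres_class R (a @ b)) =
      (\<Union>a\<in>pres_class R u. \<Union>b\<in>pres_class R v. pres_class R (u @ v))"
    by (intro SUP_cong HOL.refl *)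
  also have "\<dots> = pres_class R (u @ v)"
    using self[of u] self[of v] by blast
  finally show ?thesis
    by (simp only: presented_group_def monoid.simps partial_object.simps)
qed

lemma presented_group_carrier: "carrier (presented_group R) = range (pres_class R)"
  and presented_group_one: "\<one>\<^bsub>presented_group R\<^esub> = pres_class R []"
  by (simp_all add: presented_group_def)

lemma pres_eq_inverse_word: "pres_eq R (rev (map (map_prod id Not) u) @ u) []"
proof (induction u)
  case Nil
  show ?case by (simp add: pres_eq.refl)
next
  case (Cons p u)
  obtain a e where p: "p = (a, e)" by force
  let ?w = "rev (map (map_prod id Not) u)"
  have "pres_eq R ([(a, \<not> e)] @ [(a, e)]) []"
    using pres_eq.cancel[of R a "\<not> e"] by simp
  then have "pres_eq R (?w @ (([(a, \<not> e)] @ [(a, e)]) @ u)) (?w @ ([] @ u))"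
    by (intro pres_eq.append pres_eq.refl)
  then have "pres_eq R (?w @ (([(a, \<not> e)] @ [(a, e)]) @ u)) (?w @ u)"
    by (simp only: append_Nil)
  from pres_eq.trans[OF this Cons.IH] show ?case
    by (simp add: p id_def)
qed

lemma group_presented_group: "group (presented_group R)"
proof (rule groupI)
  fix A assume "A \<in> carrier (presented_group R)"
  then obtain u where "A = pres_class R u" by (auto simp: presented_group_carrier)
  then show "\<exists>B\<in>carrier (presented_group R). B \<otimes>\<^bsub>presented_group R\<^esub> A = \<one>\<^bsub>presented_group R\<^esub>"
    using pres_eq_inverse_word[of R u]
    by (auto simp: presented_group_carrier presented_group_one presented_group_mult
        pres_class_eq_iff)
qed (auto simp: presented_group_carrier presented_group_one presented_group_mult)

section \<open>The dicyclic group of order \<open>4n\<close>\<close>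

datatype dc_gen = DcX | DcY

definition dicyclic_relations :: "nat \<Rightarrow> (dc_gen word \<times> dc_gen word) set" where
  "dicyclic_relations n =
     {(replicate (2 * n) (DcX, True), []),
      ([(DcY, True), (DcY, True)], replicate n (DcX, True)),
      ([(DcY, False), (DcX, True), (DcY, True)], [(DcX, False)])}"

definition dicyclic :: "nat \<Rightarrow> dc_gen word set monoid" where
  "dicyclic n = presented_group (dicyclic_relations n)"

definition dc_x :: "nat \<Rightarrow> dc_gen word set" where
  "dc_x n = pres_class (dicyclic_relations n) [(DcX, True)]"

definition dc_y :: "nat \<Rightarrow> dc_gen word set" where
  "dc_y n = pres_class (dicyclic_relations n) [(DcY, True)]"

lemma group_dicyclic: "group (dicyclic n)"
  unfolding dicyclic_def by (rule group_presented_group)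

lemma dc_generators_in_carrier [simp]:
  "dc_x n \<in> carrier (dicyclic n)" "dc_y n \<in> carrier (dicyclic n)"
  by (auto simp: dicyclic_def dc_x_def dc_y_def presented_group_carrier)

lemma dc_x_pow: "dc_x n [^]\<^bsub>dicyclic n\<^esub> (k::nat)
    = pres_class (dicyclic_relations n) (replicate k (DcX, True))"
proof -
  interpret group "dicyclic n" by (rule group_dicyclic)
  show ?thesis
  proof (induction k)
    case 0
    show ?case by (simp add: dicyclic_def presented_group_one)
  next
    case (Suc k)
    then show ?case
      by (simp add: dc_x_def dicyclic_def presented_group_mult replicate_append_same)
  qed
qed

lemma dc_x_inv: "inv\<^bsub>dicyclic n\<^esub> (dc_x n) = pres_class (dicyclic_relations n) [(DcX, False)]"
  and dc_y_inv: "inv\<^bsub>dicyclic n\<^esub> (dc_y n) = pres_class (dicyclic_relations n) [(DcY, False)]"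
proof -
  interpret group "dicyclic n" by (rule group_dicyclic)
  have *: "inv\<^bsub>dicyclic n\<^esub> (pres_class (dicyclic_relations n) [(a, True)])
      = pres_class (dicyclic_relations n) [(a, False)]" for a
    by (rule inv_equality)
      (use pres_eq.cancel[of "dicyclic_relations n" a False] in
        \<open>auto simp: dicyclic_def presented_group_carrier presented_group_one
          presented_group_mult pres_class_eq_iff\<close>)
  show "inv\<^bsub>dicyclic n\<^esub> (dc_x n) = pres_class (dicyclic_relations n) [(DcX, False)]"
    "inv\<^bsub>dicyclic n\<^esub> (dc_y n) = pres_class (dicyclic_relations n) [(DcY, False)]"
    by (simp_all add: dc_x_def dc_y_def *)
qed

lemma dicyclic_relations_hold:
  fixes n defines "G \<equiv> dicyclic n"
  shows "dc_x n [^]\<^bsub>G\<^esub> (2 * n) = \<one>\<^bsub>G\<^esub>"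
    and "dc_y n [^]\<^bsub>G\<^esub> (2::nat) = dc_x n [^]\<^bsub>G\<^esub> n"
    and "inv\<^bsub>G\<^esub> (dc_y n) \<otimes>\<^bsub>G\<^esub> dc_x n \<otimes>\<^bsub>G\<^esub> dc_y n = inv\<^bsub>G\<^esub> (dc_x n)"
proof -
  interpret group G unfolding G_def by (rule group_dicyclic)
  have rel: "pres_class (dicyclic_relations n) u = pres_class (dicyclic_relations n) v"
    if "(u, v) \<in> dicyclic_relations n" for u v
    using that by (simp add: pres_class_eq_iff pres_eq.relation)
  show "dc_x n [^]\<^bsub>G\<^esub> (2 * n) = \<one>\<^bsub>G\<^esub>"
    unfolding G_def dc_x_pow
    by (simp only: dicyclic_def presented_group_one) (rule rel, simp add: dicyclic_relations_def)
  have "dc_y n [^]\<^bsub>G\<^esub> (2::nat) = dc_y n \<otimes>\<^bsub>G\<^esub> dc_y n"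
    by (simp add: numeral_2_eq_2 G_def monoid.nat_pow_Suc group.is_monoid[OF group_dicyclic]
        monoid.l_one)
  then show "dc_y n [^]\<^bsub>G\<^esub> (2::nat) = dc_x n [^]\<^bsub>G\<^esub> n"
    unfolding G_def dc_x_pow
    by (simp add: dicyclic_def dc_y_def presented_group_mult)
      (rule rel, simp add: dicyclic_relations_def)
  show "inv\<^bsub>G\<^esub> (dc_y n) \<otimes>\<^bsub>G\<^esub> dc_x n \<otimes>\<^bsub>G\<^esub> dc_y n = inv\<^bsub>G\<^esub> (dc_x n)"
    unfolding G_def dc_x_inv dc_y_inv
    by (simp add: dicyclic_def dc_x_def dc_y_def presented_group_mult)
      (rule rel, simp add: dicyclic_relations_def)
qed

section \<open>Involutions\<close>

text \<open>The identity automorphism counts as an involution: it is \<open>\<phi>\<^bsub>(1,0)\<^esub>\<close>, which satisfies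
  \<open>r\<^sup>2 = 1\<close> and \<open>s (1 + r) = 0\<close>.\<close>

definition involution :: "('a, 'b) monoid_scheme \<Rightarrow> ('a \<Rightarrow> 'a) \<Rightarrow> bool" where
  "involution G \<phi> \<longleftrightarrow>
     \<phi> \<in> carrier (AutoGroup G) \<and> \<phi> \<otimes>\<^bsub>AutoGroup G\<^esub> \<phi> = \<one>\<^bsub>AutoGroup G\<^esub>"

end

theory Submission
  imports Defs
begin

text \<open>
  Since \<open>x\<close> and \<open>y\<close> generate \<open>G = Dc\<^sub>n\<close>, the automorphism \<open>\<phi>\<^sup>2\<close> is trivial exactly when it
  fixes both of them (\<open>presented_group_hom_eqI\<close>). A direct calculation gives
  \<open>\<phi>\<^sup>2(x) = x\<^bsup>r\<^sup>2\<^esup>\<close> and \<open>\<phi>\<^sup>2(y) = y x\<^bsup>s\<^esup> x\<^bsup>rs\<^esup> = y x\<^bsup>s(1 + r)\<^esup>\<close>, so triviality amounts to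
  \<open>x\<^bsup>r\<^sup>2 - 1\<^esup> = 1\<close> and \<open>x\<^bsup>s(1 + r)\<^esup> = 1\<close>. These are the two congruences modulo \<open>2n\<close> once \<open>x\<close> is
  known to have order exactly \<open>2n\<close> (\<open>ord_dc_x\<close>).

  The relations only say that the order of \<open>x\<close> divides \<open>2n\<close>; that it is no smaller needs a model
  of the presentation. The model is the faithful two-dimensional complex representation
  \<open>x \<mapsto> diag(\<zeta>, \<zeta>\<^sup>-\<^sup>1)\<close>, \<open>y \<mapsto> (a, b) \<mapsto> (-b, a)\<close>, where \<open>\<zeta> = exp(\<pi>i/n)\<close> is a primitive \<open>2n\<close>-th
  root of unity.
\<close>

section \<open>Groups given by generators and relations\<close>

text \<open>Von Dyck's principle, phrased for actions on a set: letting every letter act so that formal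
  inverses and the two sides of each relation act alike yields an action of the presented group.
  This is how words are shown to be distinct in it.\<close>

lemma pres_eq_imp_foldr_eq:
  assumes "pres_eq R u v"
    and inverse: "\<And>a e p. act (a, e) (act (a, \<not> e) p) = p"
    and relation: "\<And>u v. (u, v) \<in> R \<Longrightarrow> foldr act u = foldr act v"
  shows "foldr act u = foldr act v"
  using assms(1)
  by induction (auto simp: inverse fun_eq_iff dest: relation)

lemma inv_pres_class_letter:
  "inv\<^bsub>presented_group R\<^esub> (pres_class R [(a, True)]) = pres_class R [(a, False)]"
proof -
  interpret group "presented_group R" by (rule group_presented_group)
  show ?thesis
    by (rule inv_equality)
      (use pres_eq.cancel[of R a False] in
        \<open>auto simp: presented_group_carrier presented_group_one presented_group_mult
          pres_class_eq_iff\<close>)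
qed

text \<open>Every class is a product of classes of letters, and the class of a formal inverse is the
  inverse of the class of its generator; hence two homomorphisms that agree on the generators
  agree on every word, by induction on its length.\<close>

lemma presented_group_hom_eqI:
  assumes f: "f \<in> hom (presented_group R) H" and g: "g \<in> hom (presented_group R) H"
    and H: "group H"
    and generators: "\<And>a. f (pres_class R [(a, True)]) = g (pres_class R [(a, True)])"
    and A: "A \<in> carrier (presented_group R)"
  shows "f A = g A"
proof -
  interpret f: group_hom "presented_group R" H f
    using f H by (simp add: group_hom_def group_hom_axioms_def group_presented_group)
  interpret g: group_hom "presented_group R" H g
    using g H by (simp add: group_hom_def group_hom_axioms_def group_presented_group)
  have mem: "pres_class R u \<in> carrier (presented_group R)" for u
    by (simp add: presented_group_carrier)
  have letter: "f (pres_class R [(a, e)]) = g (pres_class R [(a, e)])" for a e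
  proof (cases e)
    case True
    then show ?thesis by (simp add: generators)
  next
    case False
    then show ?thesis
      using f.hom_inv[OF mem, of "[(a, True)]"] g.hom_inv[OF mem, of "[(a, True)]"] generators[of a]
      by (simp add: inv_pres_class_letter)
  qed
  have "f (pres_class R u) = g (pres_class R u)" for u
  proof (induction u)
    case Nil
    show ?case by (simp flip: presented_group_one)
  next
    case (Cons p u)
    obtain a e where "p = (a, e)" by force
    moreover have "pres_class R ((a, e) # u)
        = pres_class R [(a, e)] \<otimes>\<^bsub>presented_group R\<^esub> pres_class R u"
      by (simp add: presented_group_mult)
    ultimately show ?case
      using Cons.IH letter by (simp add: mem)
  qed
  then show ?thesis
    using A by (auto simp: presented_group_carrier)
qed

lemma dicyclic_hom_eqI:
  assumes "f \<in> hom (dicyclic n) H" "g \<in> hom (dicyclic n) H" "group H"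
    and "f (dc_x n) = g (dc_x n)" "f (dc_y n) = g (dc_y n)"
    and "A \<in> carrier (dicyclic n)"
  shows "f A = g A"
proof -
  have generators: "f (pres_class (dicyclic_relations n) [(a, True)])
      = g (pres_class (dicyclic_relations n) [(a, True)])" for a
    using assms(4,5) by (cases a) (simp_all add: dc_x_def dc_y_def)
  show ?thesis
    by (rule presented_group_hom_eqI[where f = f and g = g and H = H
          and R = "dicyclic_relations n"])
      (use assms generators in \<open>simp_all add: dicyclic_def\<close>)
qed

section \<open>The order of the cyclic generator\<close>

text \<open>For \<open>\<zeta>\<^sup>n = -1\<close> these are the matrices of a two-dimensional representation of \<open>Dc\<^sub>n\<close>,
  written as maps of \<open>\<complex>\<^sup>2\<close> so that a word acts by \<open>foldr\<close>.\<close>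

fun dc_act :: "complex \<Rightarrow> dc_gen \<times> bool \<Rightarrow> complex \<times> complex \<Rightarrow> complex \<times> complex" where
  "dc_act \<zeta> (DcX, True) (a, b) = (\<zeta> * a, inverse \<zeta> * b)"
| "dc_act \<zeta> (DcX, False) (a, b) = (inverse \<zeta> * a, \<zeta> * b)"
| "dc_act \<zeta> (DcY, True) (a, b) = (- b, a)"
| "dc_act \<zeta> (DcY, False) (a, b) = (b, - a)"

lemma dc_act_x_funpow:
  "(dc_act \<zeta> (DcX, True) ^^ k) (a, b) = (\<zeta> ^ k * a, inverse \<zeta> ^ k * b)"
  by (induction k) (auto simp: mult_ac)

lemma dicyclic_pres_eq_imp_dc_act_eq:
  assumes \<zeta>: "\<zeta> ^ n = -1" "\<zeta> \<noteq> 0"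
    and "pres_eq (dicyclic_relations n) u v"
  shows "foldr (dc_act \<zeta>) u = foldr (dc_act \<zeta>) v"
  using assms(3)
proof (rule pres_eq_imp_foldr_eq)
  show "dc_act \<zeta> (a, e) (dc_act \<zeta> (a, \<not> e) p) = p" for a e p
    using \<zeta>(2) by (cases a; cases e; cases p) auto
next
  fix u v assume "(u, v) \<in> dicyclic_relations n"
  moreover have "\<zeta> ^ (2 * n) = 1" "inverse \<zeta> ^ (2 * n) = 1" "inverse \<zeta> ^ n = -1"
    using \<zeta>(1) by (simp_all add: mult.commute[of 2] power_mult power_inverse)
  ultimately show "foldr (dc_act \<zeta>) u = foldr (dc_act \<zeta>) v"
    using \<zeta> by (auto simp: dicyclic_relations_def fun_eq_iff dc_act_x_funpow)
qed

lemma cis_pi_div_pow_eq_1_iff: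
  fixes n k :: nat
  assumes "n > 0"
  shows "cis (pi / n) ^ k = 1 \<longleftrightarrow> 2 * n dvd k"
proof
  assume "cis (pi / n) ^ k = 1"
  then have "cos (k * (pi / n)) = 1"
    by (simp add: DeMoivre complex_eq_iff)
  then obtain m :: int where "k * (pi / n) = m * 2 * pi"
    by (auto simp: cos_one_2pi_int)
  then have "real_of_int (int k) = real_of_int (int (2 * n) * m)"
    using assms by (simp add: field_simps)
  then have "int k = int (2 * n) * m"
    by (simp only: of_int_eq_iff)
  then show "2 * n dvd k"
    by (metis dvd_triv_left int_dvd_int_iff)
next
  assume "2 * n dvd k"
  then obtain m where "k = 2 * n * m" ..
  then have "cis (pi / n) ^ k = (cis (pi / n) ^ (2 * n)) ^ m"
    by (simp add: power_mult)
  also have "cis (pi / n) ^ (2 * n) = 1"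
    using assms by (simp only: DeMoivre) simp
  finally show "cis (pi / n) ^ k = 1" by simp
qed

text \<open>If \<open>x\<^sup>k = 1\<close>, then the word \<open>x \<dots> x\<close> of length \<open>k\<close> acts trivially on the first basis vector,
  which it multiplies by \<open>\<zeta>\<^sup>k\<close>; so \<open>\<zeta>\<^sup>k = 1\<close> and \<open>2n\<close> divides \<open>k\<close>.\<close>

lemma ord_dc_x:
  assumes "n > 0"
  shows "group.ord (dicyclic n) (dc_x n) = 2 * n"
proof -
  interpret group "dicyclic n" by (rule group_dicyclic)
  define \<zeta> where "\<zeta> = cis (pi / n)"
  have \<zeta>: "\<zeta> ^ n = -1" "\<zeta> \<noteq> 0"
    using assms by (simp_all add: \<zeta>_def DeMoivre)
  have "2 * n dvd k" if "dc_x n [^]\<^bsub>dicyclic n\<^esub> k = \<one>\<^bsub>dicyclic n\<^esub>" for k :: nat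
  proof -
    have "pres_eq (dicyclic_relations n) (replicate k (DcX, True)) []"
      using that unfolding dc_x_pow
      by (simp add: dicyclic_def presented_group_one pres_class_eq_iff)
    from dicyclic_pres_eq_imp_dc_act_eq[OF \<zeta> this]
    have "foldr (dc_act \<zeta>) (replicate k (DcX, True)) (1, 0) = (1, 0)"
      by simp
    then have "\<zeta> ^ k = 1"
      by (simp add: dc_act_x_funpow)
    then show ?thesis
      using assms by (simp add: \<zeta>_def cis_pi_div_pow_eq_1_iff)
  qed
  moreover have "dc_x n [^]\<^bsub>dicyclic n\<^esub> (2 * n) = \<one>\<^bsub>dicyclic n\<^esub>"
    by (rule dicyclic_relations_hold)
  ultimately show ?thesis
    unfolding pow_eq_id[OF dc_generators_in_carrier(1)] by (intro dvd_antisym) auto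
qed

lemma dc_x_int_pow_eq_iff:
  fixes i j :: int
  assumes "n > 0"
  shows "dc_x n [^]\<^bsub>dicyclic n\<^esub> i = dc_x n [^]\<^bsub>dicyclic n\<^esub> j \<longleftrightarrow> [i = j] (mod (2 * int n))"
  using group.int_pow_eq[OF group_dicyclic dc_generators_in_carrier(1), of n i j] assms
  by (simp add: ord_dc_x cong_iff_dvd_diff dvd_diff_commute)

section \<open>Involutory automorphisms\<close>

lemma involution_iff_pointwise:
  assumes "\<phi> \<in> carrier (AutoGroup G)"
  shows "involution G \<phi> \<longleftrightarrow> (\<forall>g\<in>carrier G. \<phi> (\<phi> g) = g)"
proof -
  have "\<phi> \<in> Bij (carrier G)"
    using assms by (simp add: AutoGroup_def auto_def)
  then have "involution G \<phi> \<longleftrightarrow> compose (carrier G) \<phi> \<phi> = (\<lambda>g\<in>carrier G. g)"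
    using assms by (simp add: involution_def AutoGroup_def BijGroup_def)
  also have "\<dots> \<longleftrightarrow> (\<forall>g\<in>carrier G. \<phi> (\<phi> g) = g)"
  proof
    assume eq: "compose (carrier G) \<phi> \<phi> = (\<lambda>g\<in>carrier G. g)"
    show "\<forall>g\<in>carrier G. \<phi> (\<phi> g) = g"
    proof
      fix g assume "g \<in> carrier G"
      then show "\<phi> (\<phi> g) = g" using fun_cong[OF eq, of g] by (simp add: compose_eq)
    qed
  next
    assume "\<forall>g\<in>carrier G. \<phi> (\<phi> g) = g"
    then show "compose (carrier G) \<phi> \<phi> = (\<lambda>g\<in>carrier G. g)"
      unfolding compose_def by (intro restrict_ext) blast
  qed
  finally show ?thesis .
qed

theorem corollary2p9:
  fixes n :: nat and r s :: int and \<phi> :: "dc_gen word set \<Rightarrow> dc_gen word set"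
  assumes "n > 2"
    and "r \<in> Units (residue_ring (2 * int n))"
    and "s \<in> carrier (residue_ring (2 * int n))"
    and "\<phi> \<in> carrier (AutoGroup (dicyclic n))"
    and "\<phi> (dc_x n) = dc_x n [^]\<^bsub>dicyclic n\<^esub> r"
    and "\<phi> (dc_y n) = dc_y n \<otimes>\<^bsub>dicyclic n\<^esub> (dc_x n [^]\<^bsub>dicyclic n\<^esub> s)"
  shows "involution (dicyclic n) \<phi> \<longleftrightarrow>
    [r\<^sup>2 = 1] (mod (2 * int n)) \<and> [s * (1 + r) = 0] (mod (2 * int n))"
proof -
  let ?G = "dicyclic n" and ?x = "dc_x n" and ?y = "dc_y n"
  have n: "n > 0" using assms(1) by simp
  have hom: "\<phi> \<in> hom ?G ?G"
    using assms(4) by (simp add: AutoGroup_def auto_def)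
  interpret G: group ?G by (rule group_dicyclic)
  interpret \<phi>: group_hom ?G ?G \<phi>
    using hom by unfold_locales
  note x = dc_generators_in_carrier(1)[of n] and y = dc_generators_in_carrier(2)[of n]
  have \<phi>_x_pow: "\<phi> (?x [^]\<^bsub>?G\<^esub> k) = ?x [^]\<^bsub>?G\<^esub> (r * k)" for k :: int
    by (simp add: \<phi>.hom_int_pow assms(5) G.int_pow_pow)
  have \<phi>\<phi>_x: "\<phi> (\<phi> ?x) = ?x [^]\<^bsub>?G\<^esub> (r\<^sup>2)"
    by (simp add: assms(5) \<phi>_x_pow power2_eq_square)
  have "\<phi> (\<phi> ?y) = \<phi> ?y \<otimes>\<^bsub>?G\<^esub> \<phi> (?x [^]\<^bsub>?G\<^esub> s)"
    by (subst assms(6)) simp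
  also have "\<dots> = ?y \<otimes>\<^bsub>?G\<^esub> ?x [^]\<^bsub>?G\<^esub> (s * (1 + r))"
    by (simp add: assms(6) \<phi>_x_pow G.m_assoc distrib_left mult.commute[of r]
        flip: G.int_pow_mult)
  finally have \<phi>\<phi>_y: "\<phi> (\<phi> ?y) = ?y \<otimes>\<^bsub>?G\<^esub> ?x [^]\<^bsub>?G\<^esub> (s * (1 + r))" .
  have "involution ?G \<phi> \<longleftrightarrow> (\<forall>g\<in>carrier ?G. \<phi> (\<phi> g) = g)"
    by (rule involution_iff_pointwise[OF assms(4)])
  also have "\<dots> \<longleftrightarrow> \<phi> (\<phi> ?x) = ?x \<and> \<phi> (\<phi> ?y) = ?y"
  proof
    assume fixed: "\<phi> (\<phi> ?x) = ?x \<and> \<phi> (\<phi> ?y) = ?y"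
    have "\<phi> \<circ> \<phi> \<in> hom ?G ?G" "(\<lambda>g. g) \<in> hom ?G ?G"
      using hom by (auto simp: hom_def)
    from dicyclic_hom_eqI[OF this G.is_group] fixed
    show "\<forall>g\<in>carrier ?G. \<phi> (\<phi> g) = g" by simp
  qed simp
  also have "\<phi> (\<phi> ?x) = ?x \<longleftrightarrow> [r\<^sup>2 = 1] (mod (2 * int n))"
    using dc_x_int_pow_eq_iff[OF n, of "r\<^sup>2" 1] by (simp add: \<phi>\<phi>_x)
  also have "\<phi> (\<phi> ?y) = ?y \<longleftrightarrow> [s * (1 + r) = 0] (mod (2 * int n))"
    using dc_x_int_pow_eq_iff[OF n, of "s * (1 + r)" 0] by (simp add: \<phi>\<phi>_y)
  finally show ?thesis .
qed

end
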